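(* Let $f:\mathbb{C}\to\mathbb{C}$ be a transcendental entire function in the Eremenko--Lyubich class $\mathcal{B}$. Then $Q(f)=A(f)$, where $Q(f)$ is the quite fast escaping set of $f$ and $A(f)$ is the fast escaping set of $f$.
   Context: Here $\mathbb{N}=\{1,2,\dots\}$ and $f^n$ denotes the $n$th iterate of $f$. The class $\mathcal{B}$ consists of the transcendental entire functions whose set of singular values (that is, critical values and finite asymptotic values) is bounded. Put $M(r)=M(r,f)=\max_{|z|=r}|f(z)|$ for $r>0$, and let $M^n(r)$ denote the $n$th iterate of the function $M$. The fast escaping set is $$A(f)=\{z\in\mathbb{C}:\text{there exists }\ell\in\mathbb{N}\text{ such that }|f^{n+\ell}(z)|\ge M^n(R)\text{ for all }n\in\mathbb{N}\},$$ where $R>0$ is any value such that $M(r)>r$ for $r\ge R$. For $0<\varepsilon<1$ put $\mu_\varepsilon(r)=M(r)^\varepsilon$, $r>0$, with iterates $\mu_\varepsilon^n$, and $$Q_\varepsilon(f)=\{z\in\mathbb{C}:\text{there exists }\ell\in\mathbb{N}\text{ such that }|f^{n+\ell}(z)|\ge \mu_\varepsilon^n(R)\text{ for all }n\in\mathbb{N}\},$$ where $R>0$ is any value such that $\mu_\varepsilon(r)>r$ for $r\ge R$. These definitions do not depend on the choice of such $R$. The quite fast escaping set is $Q(f)=\bigcup_{0<\varepsilon<1}Q_\varepsilon(f)$. *)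

theory Defs
  imports "HOL-Complex_Analysis.Complex_Analysis"
begin

definition transcendental_entire :: "(complex \<Rightarrow> complex) \<Rightarrow> bool" where
  "transcendental_entire f \<longleftrightarrow>
     f holomorphic_on UNIV \<and> \<not> (\<exists>p :: complex poly. \<forall>z. f z = poly p z)"

definition critical_values :: "(complex \<Rightarrow> complex) \<Rightarrow> complex set" where
  "critical_values f = f ` {z. deriv f z = 0}"

definition asymptotic_values :: "(complex \<Rightarrow> complex) \<Rightarrow> complex set" where
  "asymptotic_values f =
     {a. \<exists>\<gamma> :: real \<Rightarrow> complex. continuous_on {0..} \<gamma> \<and>
           filterlim \<gamma> at_infinity at_top \<and> ((\<lambda>t. f (\<gamma> t)) \<longlongrightarrow> a) at_top}"

definition singular_values :: "(complex \<Rightarrow> complex) \<Rightarrow> complex set" where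
  "singular_values f = critical_values f \<union> asymptotic_values f"

definition class_B :: "(complex \<Rightarrow> complex) set" where
  "class_B = {f. transcendental_entire f \<and> bounded (singular_values f)}"

text \<open>For continuous \<open>f\<close> and \<open>r > 0\<close> the supremum below is attained, the circle being compact.
  Values at \<open>r \<le> 0\<close> are never used: the iterations below start at some \<open>R > 0\<close> from which
  they increase.\<close>

definition max_modulus :: "(complex \<Rightarrow> complex) \<Rightarrow> real \<Rightarrow> real" where
  "max_modulus f r = (SUP z\<in>sphere 0 r. norm (f z))"

definition mu :: "(complex \<Rightarrow> complex) \<Rightarrow> real \<Rightarrow> real \<Rightarrow> real" where
  "mu f \<epsilon> r = max_modulus f r powr \<epsilon>"

text \<open>The starting radius \<open>R\<close> is an arbitrary admissible one, on which the escaping sets do not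
  depend. It is kept as an explicit parameter rather than fixed by a choice operator, so that
  statements can quantify over all admissible radii.\<close>

definition admissible_radius :: "(real \<Rightarrow> real) \<Rightarrow> real \<Rightarrow> bool" where
  "admissible_radius m R \<longleftrightarrow> R > 0 \<and> (\<forall>r\<ge>R. m r > r)"

text \<open>The bounds \<open>l \<ge> 1\<close> and \<open>n \<ge> 1\<close> reflect the convention that the natural numbers
  start at 1.\<close>

definition fast_escaping_set :: "(complex \<Rightarrow> complex) \<Rightarrow> real \<Rightarrow> complex set" where
  "fast_escaping_set f R =
     {z. \<exists>l\<ge>1. \<forall>n\<ge>1. norm ((f ^^ (n + l)) z) \<ge> (max_modulus f ^^ n) R}"

definition Q_set :: "(complex \<Rightarrow> complex) \<Rightarrow> real \<Rightarrow> real \<Rightarrow> complex set" where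
  "Q_set f \<epsilon> R =
     {z. \<exists>l\<ge>1. \<forall>n\<ge>1. norm ((f ^^ (n + l)) z) \<ge> (mu f \<epsilon> ^^ n) R}"

text \<open>The admissible radii depend on \<open>\<epsilon>\<close>, so \<open>\<rho>\<close> assigns a starting radius to each \<open>\<epsilon>\<close>.\<close>

definition quite_fast_escaping_set ::
    "(complex \<Rightarrow> complex) \<Rightarrow> (real \<Rightarrow> real) \<Rightarrow> complex set" where
  "quite_fast_escaping_set f \<rho> = (\<Union>\<epsilon>\<in>{0<..<1}. Q_set f \<epsilon> (\<rho> \<epsilon>))"

end

theory Submission
  imports Defs
begin

text \<open>
  If \<open>R\<close> bounds the singular values and \<open>\<bar>f 0\<bar>\<close>, then \<open>f\<close> has no critical points where \<open>\<bar>f\<bar> > R\<close> and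
  lifts of curves avoiding the disc of radius \<open>R\<close> cannot escape to infinity, so each point with
  \<open>\<bar>f\<bar> > R\<close> lies on a branch \<open>g\<close> with \<open>f \<circ> g = exp\<close> on the half-plane \<open>Re \<zeta> > ln R\<close>. Such a \<open>g\<close> is
  injective because \<open>f\<close> is not a polynomial; hence the image of \<open>G = ln g\<close> contains no two points
  differing by \<open>2 * pi * \<i>\<close>, and Bloch's theorem yields the Eremenko-Lyubich type estimate
  \<open>\<bar>G' \<zeta>\<bar> * (Re \<zeta> - ln R) \<le> 48 * pi\<close>. Following \<open>g\<close> along a horizontal segment from a point of maximum
  modulus on \<open>\<bar>z\<bar> = s\<close> multiplies \<open>ln \<bar>f\<bar>\<close> by any prescribed factor, at the cost of
  a bounded factor in \<open>\<bar>z\<bar>\<close>. So \<open>M (s\<^sup>2) powr \<epsilon> \<ge> (M s)\<^sup>2\<close> for large \<open>s\<close>, which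
  iterates to \<open>\<mu>\<^sup>n (S\<^sup>2) \<ge> (M\<^sup>n S)\<^sup>2\<close>.
\<close>

section \<open>Gluing, local inverses and uniqueness of lifts\<close>

lemma holomorphic_glue:
  assumes "\<And>i. i \<in> I \<Longrightarrow> open (T i)"
    and "\<And>i. i \<in> I \<Longrightarrow> h i holomorphic_on T i"
    and eq: "\<And>i j x. \<lbrakk>i \<in> I; j \<in> I; x \<in> T i; x \<in> T j\<rbrakk> \<Longrightarrow> h i x = h j x"
  obtains g where "g holomorphic_on (\<Union>i\<in>I. T i)" "\<And>i x. \<lbrakk>i \<in> I; x \<in> T i\<rbrakk> \<Longrightarrow> g x = h i x"
proof -
  define g where "g x = h (SOME i. i \<in> I \<and> x \<in> T i) x" for x
  have g: "g x = h i x" if "i \<in> I" "x \<in> T i" for i x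
    unfolding g_def using someI[of "\<lambda>i. i \<in> I \<and> x \<in> T i" i] that by (intro eq) auto
  have "g holomorphic_on T i" if "i \<in> I" for i
    using holomorphic_transform[OF assms(2)[OF that], of g] g that by auto
  then have "g holomorphic_on (\<Union>i\<in>I. T i)"
    using assms(1) by (intro holomorphic_on_UN_open) auto
  with g that show ?thesis by blast
qed

text \<open>The last two conditions confine critical and asymptotic values to the closed disc of
  radius \<open>R\<close>, but serve different purposes: one gives local inverses of
  \<open>f\<close> over the complement of the disc, the other keeps lifts of curves converging to a
  point there from escaping to infinity.\<close>

locale log_covering =
  fixes f :: "complex \<Rightarrow> complex" and R :: real
  assumes entire: "f holomorphic_on UNIV"
    and R_pos: "R > 0"
    and noncritical: "\<And>z. norm (f z) > R \<Longrightarrow> deriv f z \<noteq> 0"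
    and asymptotic: "\<And>a. a \<in> asymptotic_values f \<Longrightarrow> norm a \<le> R"
begin

lemma cont_f: "continuous_on S f"
  using entire holomorphic_on_imp_continuous_on continuous_on_subset by blast

lemma local_inverse:
  assumes "norm (f z) > R"
  obtains N h where "open N" "z \<in> N" "inj_on f N" "open (f ` N)" "h holomorphic_on (f ` N)"
    "\<And>w. w \<in> f ` N \<Longrightarrow> f (h w) = w" "\<And>w. w \<in> f ` N \<Longrightarrow> h w \<in> N"
proof -
  obtain r where r: "r > 0" "open (f ` ball z r)" "inj_on f (ball z r)"
    using has_complex_derivative_locally_invertible[OF entire _ _ noncritical[OF assms]] by auto
  have "f holomorphic_on ball z r" using entire holomorphic_on_subset by blast
  from holomorphic_has_inverse[OF this open_ball r(3)]
  obtain h where h: "h holomorphic_on (f ` ball z r)" "\<And>w. w \<in> ball z r \<Longrightarrow> h (f w) = w"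
    by metis
  show ?thesis
    by (rule that[of "ball z r" h]) (use r h in auto)
qed

text \<open>The set where the two lifts agree is closed by continuity and open because
  \<open>f\<close> is injective near a common value.\<close>

lemma lift_unique:
  assumes "open S" "connected S" and g: "continuous_on S g" and h: "continuous_on S h"
    and eq: "\<And>x. x \<in> S \<Longrightarrow> f (g x) = f (h x)" and big: "\<And>x. x \<in> S \<Longrightarrow> norm (f (g x)) > R"
    and "p \<in> S" "g p = h p" "x \<in> S"
  shows "g x = h x"
proof -
  define A where "A = {x \<in> S. g x = h x}"
  have "closedin (top_of_set S) A"
    using continuous_closedin_preimage_constant[OF continuous_on_diff[OF g h], of 0]
    by (simp add: A_def)
  moreover have "openin (top_of_set S) A"
  proof -
    have "\<exists>U. open U \<and> a \<in> U \<and> U \<subseteq> A" if "a \<in> A" for a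
    proof -
      have a: "a \<in> S" "g a = h a" using that by (auto simp: A_def)
      obtain N k where N: "open N" "g a \<in> N" "inj_on f N"
        by (rule local_inverse[OF big[OF a(1)]])
      define U where "U = (S \<inter> g -` N) \<inter> (S \<inter> h -` N)"
      have "open U" unfolding U_def
        using continuous_open_preimage[OF g \<open>open S\<close> N(1)] continuous_open_preimage[OF h \<open>open S\<close> N(1)]
        by (rule open_Int)
      moreover have "a \<in> U" using a N by (auto simp: U_def)
      moreover have "U \<subseteq> A"
        using eq inj_onD[OF N(3)] by (auto simp: U_def A_def)
      ultimately show ?thesis by blast
    qed
    then have "open A" by (subst open_subopen) auto
    moreover have "A \<subseteq> S" by (auto simp: A_def)
    ultimately show ?thesis
      using open_subset by blast
  qed
  ultimately have "A = {} \<or> A = S"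
    using \<open>connected S\<close> by (auto simp: connected_clopen)
  then show ?thesis using assms(7-9) by (auto simp: A_def)
qed

section \<open>Lifting through \<open>f\<close> on the unit disc\<close>

text \<open>A radial lift towards \<open>\<zeta>\<close> that tended to infinity would make \<open>E \<zeta>\<close> an asymptotic value; hence
  it has a finite cluster point, around which the inverse branch of \<open>f\<close> continues \<open>g\<close>.\<close>

lemma boundary_extension:
  assumes r: "0 < r" "r < 1" and g: "g holomorphic_on ball 0 r"
    and fg: "\<And>x. x \<in> ball 0 r \<Longrightarrow> f (g x) = E x"
    and E: "E holomorphic_on ball 0 1" and big: "\<And>x. x \<in> ball 0 1 \<Longrightarrow> norm (E x) > R"
    and \<zeta>: "norm \<zeta> = r"
  shows "\<exists>e h. e > 0 \<and> ball \<zeta> e \<subseteq> ball 0 1 \<and> h holomorphic_on ball \<zeta> e \<and>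
      (\<forall>x\<in>ball \<zeta> e. f (h x) = E x) \<and> (\<forall>x\<in>ball \<zeta> e \<inter> ball 0 r. h x = g x)"
proof -
  have \<zeta>1: "\<zeta> \<in> ball 0 1" using r \<zeta> by auto
  have contE: "continuous_on (ball 0 1) E" using E holomorphic_on_imp_continuous_on by blast
  have isE: "isCont E \<zeta>" using contE \<zeta>1 continuous_on_eq_continuous_at open_ball by blast
  \<comment> \<open>The radius from 0 to \<open>\<zeta>\<close> is parametrised over
    \<open>{0..}\<close> because asymptotic values are defined by curves on that ray.\<close>
  define s where "s t = of_real (t / (1 + t)) * \<zeta>" for t :: real
  have s_in: "s t \<in> ball 0 r" if "t \<ge> 0" for t
  proof -
    have "norm (s t) = t / (1 + t) * r"
      using that \<zeta> by (simp add: s_def norm_mult norm_divide del: of_real_add)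
    also have "\<dots> < 1 * r" using that r by (intro mult_strict_right_mono) auto
    finally show ?thesis by simp
  qed
  have s_lim: "(s \<longlongrightarrow> \<zeta>) at_top"
  proof -
    have "((\<lambda>t::real. t / (1 + t)) \<longlongrightarrow> 1) at_top" by real_asymp
    then have "(s \<longlongrightarrow> of_real 1 * \<zeta>) at_top"
      unfolding s_def by (intro tendsto_intros)
    then show ?thesis by simp
  qed
  define \<gamma> where "\<gamma> t = g (s t)" for t
  have f\<gamma>: "((\<lambda>t. f (\<gamma> t)) \<longlongrightarrow> E \<zeta>) at_top"
  proof (rule Lim_transform_eventually)
    show "((\<lambda>t. E (s t)) \<longlongrightarrow> E \<zeta>) at_top" using isCont_tendsto_compose[OF isE s_lim] .
    show "\<forall>\<^sub>F t in at_top. E (s t) = f (\<gamma> t)"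
      using eventually_ge_at_top[of 0] by eventually_elim (use s_in fg in \<open>auto simp: \<gamma>_def\<close>)
  qed
  have "continuous_on {0..} s" unfolding s_def
    by (intro continuous_intros) auto
  then have "continuous_on {0..} \<gamma>"
    unfolding \<gamma>_def using s_in
    by (intro continuous_on_compose2[OF holomorphic_on_imp_continuous_on[OF g]]) auto
  then have "\<not> filterlim \<gamma> at_infinity at_top"
    using f\<gamma> asymptotic[of "E \<zeta>"] big[OF \<zeta>1] by (auto simp: asymptotic_values_def)
  then obtain B where B: "\<exists>\<^sub>F t in at_top. norm (\<gamma> t) < B"
    unfolding filterlim_at_infinity_conv_norm_at_top filterlim_at_top
    by (auto simp: not_eventually not_le)
  have "\<exists>t\<ge>real n. norm (\<gamma> t) < B" for n
    using B unfolding frequently_def eventually_at_top_linorder by (auto simp: not_le)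
  then obtain t where t: "\<And>n. t n \<ge> real n" "\<And>n. norm (\<gamma> (t n)) < B" by metis
  have t_lim: "filterlim t at_top sequentially"
    using t(1) by (intro filterlim_at_top_mono[OF filterlim_real_sequentially]) auto
  have "\<forall>n. \<gamma> (t n) \<in> cball 0 B" using t(2) by (auto intro: less_imp_le)
  then obtain z q where q: "strict_mono (q :: nat \<Rightarrow> nat)" "((\<lambda>n. \<gamma> (t (q n))) \<longlonglongrightarrow> z)"
    using seq_compactE[OF compact_imp_seq_compact[OF compact_cball[of 0 B]], of "\<lambda>n. \<gamma> (t n)"]
    unfolding o_def by blast
  have tq: "filterlim (\<lambda>n. t (q n)) at_top sequentially"
    using filterlim_compose[OF t_lim filterlim_subseq[OF q(1)]] .
  have "(\<lambda>n. f (\<gamma> (t (q n)))) \<longlonglongrightarrow> f z"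
    by (rule continuous_on_tendsto_compose[OF cont_f[of UNIV] q(2)]) auto
  moreover have "(\<lambda>n. f (\<gamma> (t (q n)))) \<longlonglongrightarrow> E \<zeta>"
    using filterlim_compose[OF f\<gamma> tq] .
  ultimately have fz: "f z = E \<zeta>" using LIMSEQ_unique by blast
  obtain N k where N: "open N" "z \<in> N" "inj_on f N" "open (f ` N)" "k holomorphic_on (f ` N)"
    "\<And>w. w \<in> f ` N \<Longrightarrow> f (k w) = w" "\<And>w. w \<in> f ` N \<Longrightarrow> k w \<in> N"
    by (rule local_inverse[of z]) (use fz big[OF \<zeta>1] in auto)
  have "open (ball 0 1 \<inter> E -` (f ` N))"
    by (rule continuous_open_preimage[OF contE open_ball N(4)])
  moreover have "\<zeta> \<in> ball 0 1 \<inter> E -` (f ` N)" using \<zeta>1 N(2) by (auto simp flip: fz)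
  ultimately obtain e where e: "e > 0" "ball \<zeta> e \<subseteq> ball 0 1 \<inter> E -` (f ` N)"
    by (rule openE)
  have hol: "(k \<circ> E) holomorphic_on ball \<zeta> e"
    using e by (intro holomorphic_on_compose_gen[OF _ N(5)] holomorphic_on_subset[OF E]) auto
  have fh: "f ((k \<circ> E) x) = E x" if "x \<in> ball \<zeta> e" for x using that e N(6) by auto
  \<comment> \<open>Along the subsequence \<open>\<gamma>\<close> ends up in \<open>N\<close>, where
    \<open>f\<close> is injective. This yields a point \<open>s \<tau>\<close> at which
    \<open>k \<circ> E\<close> and \<open>g\<close> agree; uniqueness of lifts spreads the agreement
    over the convex overlap.\<close>
  have "\<forall>\<^sub>F n in sequentially. \<gamma> (t (q n)) \<in> N"
    using q(2) N(1,2) by (rule topological_tendstoD)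
  moreover have "\<forall>\<^sub>F n in sequentially. s (t (q n)) \<in> ball \<zeta> e"
    using filterlim_compose[OF s_lim tq] by (rule topological_tendstoD) (use e in auto)
  moreover have "\<forall>\<^sub>F n in sequentially. t (q n) \<ge> 0"
    using tq by (simp add: filterlim_at_top)
  ultimately have "\<forall>\<^sub>F n in sequentially. \<gamma> (t (q n)) \<in> N \<and> s (t (q n)) \<in> ball \<zeta> e \<and> t (q n) \<ge> 0"
    by eventually_elim auto
  then obtain \<tau> where \<tau>: "\<gamma> \<tau> \<in> N" "s \<tau> \<in> ball \<zeta> e" "\<tau> \<ge> 0"
    using eventually_happens'[OF sequentially_bot] by blast
  have p: "s \<tau> \<in> ball \<zeta> e \<inter> ball 0 r" using \<tau> s_in by auto
  have "f ((k \<circ> E) (s \<tau>)) = f (g (s \<tau>))" using p fh fg by auto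
  moreover have "(k \<circ> E) (s \<tau>) \<in> N" using N(7) e p by auto
  ultimately have eqp: "(k \<circ> E) (s \<tau>) = g (s \<tau>)"
    using inj_onD[OF N(3)] \<tau>(1) by (auto simp: \<gamma>_def)
  have "(k \<circ> E) x = g x" if "x \<in> ball \<zeta> e \<inter> ball 0 r" for x
  proof (rule lift_unique[where S = "ball \<zeta> e \<inter> ball 0 r" and p = "s \<tau>" and g = "k \<circ> E" and h = g])
    show "connected (ball \<zeta> e \<inter> ball 0 r)"
      by (intro convex_connected convex_Int convex_ball)
    show "continuous_on (ball \<zeta> e \<inter> ball 0 r) (k \<circ> E)"
      using holomorphic_on_imp_continuous_on[OF hol] continuous_on_subset by blast
    show "continuous_on (ball \<zeta> e \<inter> ball 0 r) g"
      using holomorphic_on_imp_continuous_on[OF g] continuous_on_subset by blast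
    show "f ((k \<circ> E) y) = f (g y)" "R < norm (f ((k \<circ> E) y))" if "y \<in> ball \<zeta> e \<inter> ball 0 r" for y
      using that fh[of y] fg[of y] big[of y] e by auto
  qed (use p eqp that in auto)
  then show ?thesis using e hol fh by blast
qed

text \<open>The discs around boundary points on which \<open>g\<close> extends form, together with
  \<open>ball 0 r\<close>, an open set containing \<open>cball 0 r\<close>; by compactness it
  contains a larger disc. The main task is to show that the extensions agree with each
  other.\<close>

lemma disc_lift_extend:
  assumes r: "0 < r" "r < 1" and g: "g holomorphic_on ball 0 r"
    and fg: "\<And>x. x \<in> ball 0 r \<Longrightarrow> f (g x) = E x"
    and E: "E holomorphic_on ball 0 1" and big: "\<And>x. x \<in> ball 0 1 \<Longrightarrow> norm (E x) > R"
  shows "\<exists>r'>r. r' \<le> 1 \<and> (\<exists>h. h holomorphic_on ball 0 r' \<and> h 0 = g 0 \<and> (\<forall>x\<in>ball 0 r'. f (h x) = E x))"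
proof -
  define P where "P \<zeta> e h \<longleftrightarrow> e > 0 \<and> ball \<zeta> e \<subseteq> ball 0 1 \<and> h holomorphic_on ball \<zeta> e \<and>
      (\<forall>x\<in>ball \<zeta> e. f (h x) = E x) \<and> (\<forall>x\<in>ball \<zeta> e \<inter> ball 0 r. h x = g x)" for \<zeta> e h
  have "\<exists>e h. P \<zeta> e h" if "norm \<zeta> = r" for \<zeta>
    unfolding P_def using boundary_extension[OF assms that] .
  then obtain e h where "\<And>\<zeta>. norm \<zeta> = r \<Longrightarrow> P \<zeta> (e \<zeta>) (h \<zeta>)" by metis
  then have e: "\<And>\<zeta>. norm \<zeta> = r \<Longrightarrow> e \<zeta> > 0" "\<And>\<zeta>. norm \<zeta> = r \<Longrightarrow> ball \<zeta> (e \<zeta>) \<subseteq> ball 0 1"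
    and h: "\<And>\<zeta>. norm \<zeta> = r \<Longrightarrow> h \<zeta> holomorphic_on ball \<zeta> (e \<zeta>)"
      "\<And>\<zeta> x. norm \<zeta> = r \<Longrightarrow> x \<in> ball \<zeta> (e \<zeta>) \<Longrightarrow> f (h \<zeta> x) = E x"
      "\<And>\<zeta> x. norm \<zeta> = r \<Longrightarrow> x \<in> ball \<zeta> (e \<zeta>) \<Longrightarrow> x \<in> ball 0 r \<Longrightarrow> h \<zeta> x = g x"
    by (simp_all add: P_def)
  have hh: "h a x = h b x" if ab: "norm a = r" "norm b = r" and x: "x \<in> ball a (e a)" "x \<in> ball b (e b)" for a b x
  proof (cases "a = b")
    case False
    let ?S = "ball a (e a) \<inter> ball b (e b)"
    \<comment> \<open>By strict convexity the overlap of two discs centred on the circle meets \<open>ball 0 r\<close>,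
      where both local extensions agree with \<open>g\<close>.\<close>
    define u where "u = e b / (e a + e b)"
    define p where "p = u *\<^sub>R a + (1 - u) *\<^sub>R b"
    have ep: "e a > 0" "e b > 0" using e ab by auto
    have u: "0 < u" "u < 1" "1 - u = e a / (e a + e b)" using ep by (auto simp: u_def field_simps)
    have d: "dist a b < e a + e b"
      using x dist_triangle_less_add[of a x "e a" b "e b"] by (simp add: dist_commute)
    have "a - p = (1 - u) *\<^sub>R (a - b)" "b - p = - u *\<^sub>R (a - b)"
      by (simp_all add: p_def algebra_simps)
    \<comment> \<open>The distances from \<open>p\<close> to \<open>a\<close> and \<open>b\<close>
      are in the ratio of \<open>e a\<close> to \<open>e b\<close>, so
      \<open>dist a b < e a + e b\<close> makes each smaller than its radius.\<close>
    then have "dist a p = (1 - u) * dist a b" "dist b p = u * dist a b"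
      using u(1,2) by (simp_all add: dist_norm norm_minus_commute)
    moreover have "(1 - u) * dist a b < (1 - u) * (e a + e b)" "u * dist a b < u * (e a + e b)"
      using d u(1,2) by simp_all
    moreover have "(1 - u) * (e a + e b) = e a" "u * (e a + e b) = e b"
      using ep unfolding u(3) by (simp_all add: u_def)
    ultimately have pS: "p \<in> ?S" by simp
    have p_r: "p \<in> ball 0 r"
    proof -
      have "p \<in> open_segment a b"
        unfolding in_segment p_def using False u by (intro conjI exI[of _ "1 - u"]) auto
      then have "dist 0 p < r"
        using dist_decreases_open_segment[of p a b 0] ab by auto
      then show ?thesis by simp
    qed
    show ?thesis
    proof (rule lift_unique[where S = ?S and p = p and g = "h a" and h = "h b"])
      show "connected ?S" by (intro convex_connected convex_Int convex_ball)
      show "continuous_on ?S (h a)" "continuous_on ?S (h b)"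
        using h(1) ab holomorphic_on_imp_continuous_on continuous_on_subset by blast+
      show "f (h a y) = f (h b y)" "R < norm (f (h a y))" if "y \<in> ?S" for y
        using that h(2)[OF ab(1), of y] h(2)[OF ab(2), of y] big[of y] e(2)[OF ab(1)] by auto
      show "h a p = h b p" using h(3) ab pS p_r by auto
    qed (use pS x in auto)
  qed auto
  \<comment> \<open>Pairing each disc with its function lets the gluing lemma be applied with
    \<open>fst\<close> and \<open>snd\<close>.\<close>
  define I where "I = insert (ball 0 r, g) ((\<lambda>\<zeta>. (ball \<zeta> (e \<zeta>), h \<zeta>)) ` sphere 0 r)"
  obtain G where G: "G holomorphic_on (\<Union>i\<in>I. fst i)" "\<And>i x. \<lbrakk>i \<in> I; x \<in> fst i\<rbrakk> \<Longrightarrow> G x = snd i x"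
  proof (rule holomorphic_glue[of I fst snd])
    show "open (fst i)" if "i \<in> I" for i using that by (auto simp: I_def)
    show "snd i holomorphic_on fst i" if "i \<in> I" for i using that g h(1) by (auto simp: I_def)
    fix i j x assume ij: "i \<in> I" "j \<in> I" and x: "x \<in> fst i" "x \<in> fst j"
    have I_cases: "k = (ball 0 r, g) \<or> (\<exists>a. norm a = r \<and> k = (ball a (e a), h a))" if "k \<in> I" for k
      using that by (auto simp: I_def)
    show "snd i x = snd j x"
      using I_cases[OF ij(1)] I_cases[OF ij(2)]
    proof (elim disjE exE conjE)
      fix a b assume "norm a = r" "i = (ball a (e a), h a)" "norm b = r" "j = (ball b (e b), h b)"
      then show ?thesis using x by (simp add: hh[of a b x])
    qed (use x h(3) in simp_all)
  qed blast
  let ?U = "\<Union>i\<in>I. fst i"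
  have sub1: "?U \<subseteq> ball 0 1" using e(2) r by (force simp: I_def)
  have fG: "f (G x) = E x" if "x \<in> ?U" for x
  proof -
    from that obtain i where i: "i \<in> I" "x \<in> fst i" by blast
    then have "f (snd i x) = E x" using h(2) fg by (auto simp: I_def)
    with G(2)[OF i] show ?thesis by simp
  qed
  have openU: "open ?U" by (auto simp: I_def)
  have "cball 0 r \<subseteq> ?U"
  proof
    fix x :: complex assume "x \<in> cball 0 r"
    then consider "x \<in> ball 0 r" | "x \<in> sphere 0 r" by fastforce
    then show "x \<in> ?U" using e(1)[of x] by cases (auto simp: I_def intro!: bexI[of _ x])
  qed
  from compact_subset_open_imp_ball_epsilon_subset[OF compact_cball openU this]
  obtain d where d: "d > 0" "(\<Union>x\<in>cball 0 r. ball x d) \<subseteq> ?U" by blast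
  have "ball 0 (r + d) \<subseteq> ?U"
  proof
    fix x :: complex assume x: "x \<in> ball 0 (r + d)"
    show "x \<in> ?U"
    proof (cases "norm x \<le> r")
      case True
      then show ?thesis using d \<open>cball 0 r \<subseteq> ?U\<close> by auto
    next
      case False
      let ?y = "(r / norm x) *\<^sub>R x"
      have "?y \<in> cball 0 r" using r by auto
      moreover have "dist ?y x = norm x - r"
      proof -
        have "?y - x = (r / norm x - 1) *\<^sub>R x" by (simp add: algebra_simps)
        then have "dist ?y x = \<bar>r / norm x - 1\<bar> * norm x" by (simp add: dist_norm)
        also have "\<dots> = norm x - r" using False r by (cases "x = 0") (simp_all add: divide_le_eq_1 abs_if algebra_simps)
        finally show ?thesis .
      qed
      moreover have "norm x - r < d" using x by simp
      ultimately have "?y \<in> cball 0 r" "x \<in> ball ?y d" by (simp_all only: mem_ball)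
      then show ?thesis using d(2) by blast
    qed
  qed
  note sub = this
  have "r + d \<le> 1"
    using order_trans[OF sub sub1] r d by (simp add: ball_subset_ball_iff)
  moreover have "G 0 = g 0" using G(2)[of "(ball 0 r, g)" 0] r by (auto simp: I_def)
  moreover have "G holomorphic_on ball 0 (r + d)" using holomorphic_on_subset[OF G(1) sub] .
  moreover have "\<forall>x\<in>ball 0 (r + d). f (G x) = E x" using fG sub by blast
  ultimately show ?thesis using d(1) by (intro exI[of _ "r + d"]) auto
qed

text \<open>A local inverse of \<open>f\<close> at \<open>z0\<close> gives a lift on a small disc.
  Lifts on different discs agree where both are defined, as all take the value \<open>z0\<close> at
  0, so they glue to a lift on the disc of supremal radius; if that radius were below 1,
  \<open>disc_lift_extend\<close> would enlarge it.\<close>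

lemma disc_lift:
  assumes E: "E holomorphic_on ball 0 1" and big: "\<And>x. x \<in> ball 0 1 \<Longrightarrow> norm (E x) > R"
    and z0: "f z0 = E 0"
  obtains g where "g holomorphic_on ball 0 1" "g 0 = z0" "\<And>x. x \<in> ball 0 1 \<Longrightarrow> f (g x) = E x"
proof -
  define L where "L r g \<longleftrightarrow> g holomorphic_on ball 0 r \<and> g 0 = z0 \<and> (\<forall>x\<in>ball 0 r. f (g x) = E x)" for r g
  define S where "S = {r. 0 < r \<and> r \<le> 1 \<and> (\<exists>g. L r g)}"
  have contE: "continuous_on (ball 0 1) E" using E holomorphic_on_imp_continuous_on by blast
  have "S \<noteq> {}"
  proof -
    obtain N k where N: "open N" "z0 \<in> N" "inj_on f N" "open (f ` N)" "k holomorphic_on (f ` N)"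
      "\<And>w. w \<in> f ` N \<Longrightarrow> f (k w) = w" "\<And>w. w \<in> f ` N \<Longrightarrow> k w \<in> N"
      by (rule local_inverse[of z0]) (use z0 big[of 0] in auto)
    have "open (ball 0 1 \<inter> E -` (f ` N))"
      by (rule continuous_open_preimage[OF contE open_ball N(4)])
    moreover have "0 \<in> ball 0 1 \<inter> E -` (f ` N)" using N(2) by (auto simp flip: z0)
    ultimately obtain e where e: "e > 0" "ball 0 e \<subseteq> ball 0 1 \<inter> E -` (f ` N)"
      by (rule openE)
    have "(k \<circ> E) holomorphic_on ball 0 e"
      using e by (intro holomorphic_on_compose_gen[OF _ N(5)] holomorphic_on_subset[OF E]) auto
    moreover have "f ((k \<circ> E) x) = E x" if "x \<in> ball 0 e" for x using that e N(6) by auto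
    moreover have "(k \<circ> E) 0 = z0"
      using z0 N by (metis comp_apply image_eqI inj_onD)
    moreover have "e \<le> 1"
    proof -
      have "ball (0::complex) e \<subseteq> ball 0 1" using e by blast
      then show ?thesis using e by (simp add: ball_subset_ball_iff)
    qed
    ultimately have "L e (k \<circ> E)" "e \<le> 1" by (simp_all add: L_def)
    then show ?thesis using e by (auto simp: S_def)
  qed
  define r where "r = Sup S"
  have bdd: "bdd_above S" by (rule bdd_aboveI[of _ 1]) (auto simp: S_def)
  have r1: "r \<le> 1" unfolding r_def using \<open>S \<noteq> {}\<close> by (intro cSup_least) (auto simp: S_def)
  have r_up: "x \<le> r" if "x \<in> S" for x unfolding r_def using that bdd by (rule cSup_upper)
  have r0: "r > 0" using \<open>S \<noteq> {}\<close> r_up by (fastforce simp: S_def)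
  have "\<forall>s\<in>S. \<exists>g. L s g" by (auto simp: S_def)
  then obtain h where h: "\<And>s. s \<in> S \<Longrightarrow> L s (h s)" by metis
  obtain g where g: "g holomorphic_on (\<Union>s\<in>S. ball 0 s)" "\<And>s x. \<lbrakk>s \<in> S; x \<in> ball 0 s\<rbrakk> \<Longrightarrow> g x = h s x"
  proof (rule holomorphic_glue[of S "ball 0" h])
    show "h s holomorphic_on ball 0 s" if "s \<in> S" for s using h[OF that] by (simp add: L_def)
    fix s t x assume st: "s \<in> S" "t \<in> S" and x: "x \<in> ball 0 s" "x \<in> ball (0::complex) t"
    have stp: "0 < s" "s \<le> 1" "0 < t" "t \<le> 1" using st by (auto simp: S_def)
    have hs: "L s (h s)" "L t (h t)" using h st by auto
    show "h s x = h t x"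
    proof (rule lift_unique[where S = "ball 0 s \<inter> ball 0 t" and p = 0 and g = "h s" and h = "h t"])
      show "connected (ball (0::complex) s \<inter> ball 0 t)" by (intro convex_connected convex_Int convex_ball)
      show "continuous_on (ball 0 s \<inter> ball 0 t) (h s)" "continuous_on (ball 0 s \<inter> ball 0 t) (h t)"
        using hs holomorphic_on_imp_continuous_on continuous_on_subset unfolding L_def by blast+
      show "f (h s y) = f (h t y)" "R < norm (f (h s y))" if "y \<in> ball 0 s \<inter> ball 0 t" for y
        using that hs big[of y] stp by (auto simp: L_def)
      show "h s 0 = h t 0" using hs by (simp add: L_def)
    qed (use x stp in auto)
  qed (simp, blast)
  have "(\<Union>s\<in>S. ball 0 s) = ball (0::complex) r"
  proof (intro equalityI subsetI)
    fix x :: complex assume "x \<in> ball 0 r"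
    then have "norm x < Sup S" by (simp add: r_def)
    then obtain s where "s \<in> S" "norm x < s" using less_cSup_iff[OF \<open>S \<noteq> {}\<close> bdd] by auto
    then show "x \<in> (\<Union>s\<in>S. ball 0 s)" by auto
  qed (use r_up in fastforce)
  with g(1) have ghol: "g holomorphic_on ball 0 r" by simp
  have Lr: "L r g"
    unfolding L_def
  proof (intro conjI ballI ghol)
    obtain s where s: "s \<in> S" using \<open>S \<noteq> {}\<close> by blast
    then have "0 \<in> ball (0::complex) s" by (auto simp: S_def)
    then show "g 0 = z0" using g(2)[OF s] h[OF s] by (simp add: L_def)
    fix x :: complex assume "x \<in> ball 0 r"
    then obtain s where "s \<in> S" "x \<in> ball 0 s" using \<open>(\<Union>s\<in>S. ball 0 s) = ball 0 r\<close> by blast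
    then show "f (g x) = E x" using g(2)[of s x] h[of s] by (simp add: L_def)
  qed
  have "r = 1"
  proof (rule ccontr)
    assume "r \<noteq> 1"
    with r1 have "r < 1" by simp
    from disc_lift_extend[OF r0 this ghol _ E big] Lr
    obtain r' g' where "r' > r" "r' \<le> 1" "L r' g'" unfolding L_def by metis
    then have "r' \<in> S" using r0 by (auto simp: S_def)
    with r_up \<open>r' > r\<close> show False by force
  qed
  with Lr show ?thesis using that by (auto simp: L_def)
qed

section \<open>Branches \<open>g\<close> with \<open>f \<circ> g = exp\<close> on a half-plane and
  their injectivity\<close>

abbreviation "halfplane \<equiv> {\<zeta>::complex. Re \<zeta> > ln R}"

lemma norm_exp_halfplane: "\<zeta> \<in> halfplane \<Longrightarrow> norm (exp \<zeta>) > R"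
  using R_pos exp_less_mono[of "ln R" "Re \<zeta>"] by simp

text \<open>The half-plane is conformally a disc, so \<open>disc_lift\<close> applies to
  \<open>exp\<close> composed with a Moebius map. Centring at \<open>\<zeta>0 = Ln (f z0)\<close>
  makes the branch pass through \<open>z0\<close>.\<close>

lemma halfplane_lift:
  assumes "norm (f z0) > R"
  obtains g \<zeta>0 where "g holomorphic_on halfplane" "\<And>\<zeta>. \<zeta> \<in> halfplane \<Longrightarrow> f (g \<zeta>) = exp \<zeta>"
    "Re \<zeta>0 = ln (norm (f z0))" "g \<zeta>0 = z0"
proof -
  define \<zeta>0 where "\<zeta>0 = Ln (f z0)"
  have fz: "f z0 \<noteq> 0" using assms R_pos by auto
  have re: "Re \<zeta>0 = ln (norm (f z0))" using fz by (simp add: \<zeta>0_def)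
  define a where "a = ln (norm (f z0)) - ln R"
  have a: "a > 0" using assms R_pos fz ln_less_cancel_iff[of R "norm (f z0)"] by (simp add: a_def)
  define L where "L = \<zeta>0 - of_real a"
  have L: "Re L = ln R" by (simp add: L_def re a_def)
  \<comment> \<open>Moebius map of the unit disc onto the half-plane with \<open>\<phi> 0 = \<zeta>0\<close>, and its inverse \<open>\<psi>\<close>\<close>
  define \<phi> where "\<phi> w = L + of_real a * ((1 + w) / (1 - w))" for w
  define \<psi> where "\<psi> \<zeta> = (\<zeta> - L - of_real a) / (\<zeta> - L + of_real a)" for \<zeta>
  have \<phi>_in: "\<phi> w \<in> halfplane" if "w \<in> ball 0 1" for w
  proof -
    have w: "norm w < 1" "w \<noteq> 1" using that by auto
    have "Re ((1 + w) * cnj (1 - w)) = 1 - (norm w)\<^sup>2"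
      by (simp add: cmod_power2) (simp add: power2_eq_square algebra_simps)
    also have "\<dots> > 0" using w by (simp add: power_less_one_iff)
    finally have "Re ((1 + w) / (1 - w)) > 0" by (simp only: Re_complex_div_gt_0)
    then have "a * Re ((1 + w) / (1 - w)) > 0" using a by (rule mult_pos_pos[rotated])
    then show ?thesis using L by (simp add: \<phi>_def del: times_divide_eq_right)
  qed
  have nz: "\<zeta> - L + of_real a \<noteq> 0" if "\<zeta> \<in> halfplane" for \<zeta>
  proof
    assume "\<zeta> - L + of_real a = 0"
    then have "Re (\<zeta> - L + of_real a) = 0" by simp
    with that a L show False by simp
  qed
  have \<psi>_in: "\<psi> \<zeta> \<in> ball 0 1" if "\<zeta> \<in> halfplane" for \<zeta>
  proof -
    \<comment> \<open>A point of the half-plane is nearer to \<open>L + a\<close> than to its mirror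
      image \<open>L - a\<close> in the boundary line.\<close>
    have "(norm (\<zeta> - L - of_real a))\<^sup>2 < (norm (\<zeta> - L + of_real a))\<^sup>2"
    proof -
      have "(Re (\<zeta> - L) - a)\<^sup>2 < (Re (\<zeta> - L) + a)\<^sup>2"
        using that a L by (simp add: power2_eq_square algebra_simps)
      then show ?thesis by (simp add: cmod_power2)
    qed
    then have "norm (\<zeta> - L - of_real a) < norm (\<zeta> - L + of_real a)"
      by (rule power2_less_imp_less) simp
    then show ?thesis using nz[OF that] by (simp add: \<psi>_def norm_divide)
  qed
  have \<phi>\<psi>: "\<phi> (\<psi> \<zeta>) = \<zeta>" if "\<zeta> \<in> halfplane" for \<zeta>
  proof -
    have "1 + \<psi> \<zeta> = 2 * (\<zeta> - L) / (\<zeta> - L + of_real a)" "1 - \<psi> \<zeta> = 2 * of_real a / (\<zeta> - L + of_real a)"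
      using nz[OF that] by (simp_all add: \<psi>_def field_simps)
    then have "(1 + \<psi> \<zeta>) / (1 - \<psi> \<zeta>) = (\<zeta> - L) / of_real a"
      using nz[OF that] a by (simp del: right_diff_distrib_numeral)
    then show ?thesis using a by (simp add: \<phi>_def)
  qed
  have \<phi>hol: "\<phi> holomorphic_on ball 0 1"
    unfolding \<phi>_def by (intro holomorphic_intros) auto
  have \<psi>hol: "\<psi> holomorphic_on halfplane"
    unfolding \<psi>_def using nz by (intro holomorphic_intros) auto
  have \<psi>0: "\<psi> \<zeta>0 = 0" by (simp add: \<psi>_def L_def)
  have \<phi>0: "\<phi> 0 = \<zeta>0" by (simp add: \<phi>_def L_def)
  obtain g where g: "g holomorphic_on ball 0 1" "g 0 = z0" "\<And>x. x \<in> ball 0 1 \<Longrightarrow> f (g x) = (exp \<circ> \<phi>) x"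
  proof (rule disc_lift[of "exp \<circ> \<phi>" z0])
    show "(exp \<circ> \<phi>) holomorphic_on ball 0 1"
      by (intro holomorphic_on_compose \<phi>hol holomorphic_intros)
    show "R < norm ((exp \<circ> \<phi>) x)" if "x \<in> ball 0 1" for x
      using norm_exp_halfplane[OF \<phi>_in[OF that]] by simp
    show "f z0 = (exp \<circ> \<phi>) 0" using fz by (simp add: \<phi>0 \<zeta>0_def)
  qed blast
  show ?thesis
  proof (rule that[of "g \<circ> \<psi>" \<zeta>0])
    show "(g \<circ> \<psi>) holomorphic_on halfplane"
      using \<psi>_in by (intro holomorphic_on_compose_gen[OF \<psi>hol g(1)]) auto
  qed (use re \<psi>0 g \<psi>_in \<phi>\<psi> in auto)
qed

text \<open>If \<open>g\<close> were not injective it would be \<open>2 * pi * \<i> * k\<close>-periodic for some \<open>k \<ge> 1\<close>; then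
  \<open>w \<mapsto> 1 / g (- k * ln w)\<close> extends to a neighbourhood of \<open>0\<close>, and since \<open>f\<close> has modulus
  \<open>\<bar>w\<bar> powr - k\<close> at the reciprocal of its value, \<open>f\<close> grows at most polynomially.\<close>

lemma halfplane_lift_inj:
  assumes transc: "transcendental_entire f"
    and g: "g holomorphic_on halfplane" and fg: "\<And>\<zeta>. \<zeta> \<in> halfplane \<Longrightarrow> f (g \<zeta>) = exp \<zeta>"
  shows "inj_on g halfplane"
proof (rule ccontr)
  assume "\<not> inj_on g halfplane"
  then obtain a b where ab: "a \<in> halfplane" "b \<in> halfplane" "a \<noteq> b" "g a = g b"
    unfolding inj_on_def by blast
  then have "exp a = exp b" using fg by metis
  then obtain k0 :: int where "a = b + (of_int (2 * k0) * pi) * \<i>" unfolding exp_eq by blast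
  then have k0: "a = b + 2 * pi * \<i> * of_int k0" by (simp add: algebra_simps)
  \<comment> \<open>Exchanging \<open>a\<close> and \<open>b\<close> if necessary makes the multiple
    of \<open>2 * pi * \<i>\<close> positive.\<close>
  obtain k :: nat and p where k: "k > 0" "p \<in> halfplane" "g (p + 2 * pi * \<i> * of_nat k) = g p"
  proof (cases "k0 > 0")
    case True
    then show ?thesis using that[of "nat k0" b] k0 ab by simp
  next
    case False
    then have "k0 < 0" using k0 ab by (cases "k0 = 0") auto
    moreover have "b = a + 2 * pi * \<i> * of_int (- k0)" using k0 by (simp add: algebra_simps)
    ultimately show ?thesis using that[of "nat (- k0)" a] ab by simp
  qed
  have conv: "convex halfplane" by (rule convex_halfspace_Re_gt)
  have opn: "open halfplane" by (rule open_halfspace_Re_gt)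
  have contg: "continuous_on halfplane g" using g holomorphic_on_imp_continuous_on by blast
  define T where "T = 2 * pi * \<i> * of_nat k"
  have ReT: "Re T = 0" by (simp add: T_def)
  have expT: "exp (\<zeta> + T) = exp \<zeta>" for \<zeta>
    by (simp add: T_def exp_eq) (metis of_int_of_nat_eq)
  have per: "g (\<zeta> + T) = g \<zeta>" if "\<zeta> \<in> halfplane" for \<zeta>
  proof (rule lift_unique[where S = halfplane and p = p and g = "\<lambda>\<zeta>. g (\<zeta> + T)" and h = g])
    show "continuous_on halfplane (\<lambda>\<zeta>. g (\<zeta> + T))"
      using ReT by (intro continuous_on_compose2[OF contg] continuous_intros) auto
    show "f (g (x + T)) = f (g x)" "R < norm (f (g (x + T)))" if "x \<in> halfplane" for x
      using that ReT fg[of x] fg[of "x + T"] norm_exp_halfplane[OF that] by (auto simp: expT)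
  qed (use conv opn convex_connected contg k that in \<open>auto simp: T_def\<close>)
  have perj: "g (\<zeta> + of_nat j * T) = g \<zeta>" if "\<zeta> \<in> halfplane" for \<zeta> and j :: nat
  proof (induction j)
    case (Suc j)
    have "\<zeta> + of_nat j * T \<in> halfplane" using that ReT by simp
    from per[OF this] Suc show ?case by (simp add: algebra_simps)
  qed simp
  have period: "g x = g y" if "x \<in> halfplane" "y \<in> halfplane" "x = y + of_int j * T" for x y and j :: int
  proof (cases "j \<ge> 0")
    case True
    then show ?thesis using perj[OF that(2), of "nat j"] that(3) by simp
  next
    case False
    then have "y = x + of_nat (nat (- j)) * T" using that(3) by (simp add: algebra_simps)
    then show ?thesis using perj[OF that(1), of "nat (- j)"] by simp
  qed
  \<comment> \<open>\<open>norm (exp l) < \<delta>\<close> means \<open>Re l < - ln R / k\<close>,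
    which puts \<open>- k * l\<close> into the half-plane.\<close>
  define \<delta> where "\<delta> = R powr (- 1 / k)"
  have \<delta>: "\<delta> > 0" using R_pos by (simp add: \<delta>_def)
  define h where "h w = g (- of_nat k * Ln w)" for w
  have in_H: "- of_nat k * l \<in> halfplane" if "norm (exp l) < \<delta>" for l
  proof -
    have "Re l < ln \<delta>" using that \<delta> exp_less_cancel_iff[of "Re l" "ln \<delta>"] by simp
    then show ?thesis using k R_pos by (simp add: \<delta>_def ln_powr field_simps)
  qed
  \<comment> \<open>Two logarithms of \<open>w\<close> give arguments of \<open>g\<close> that
    differ by a multiple of the period \<open>T\<close>. So the jump of \<open>Ln\<close> is
    harmless, and near each point \<open>h\<close> can be computed with a holomorphic
    logarithm.\<close>
  have h_eq: "h w = g (- of_nat k * l)" if "exp l = w" "norm w < \<delta>" for w l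
  proof -
    have w: "w \<noteq> 0" using that by auto
    then have "exp (Ln w) = exp l" using that by simp
    then obtain j :: int where "Ln w = l + (of_int (2 * j) * pi) * \<i>" unfolding exp_eq by blast
    then have "- of_nat k * Ln w = - of_nat k * l + of_int (- j) * T" by (simp add: T_def algebra_simps)
    then show ?thesis unfolding h_def
      using in_H[of l] in_H[of "Ln w"] that w by (intro period[where j = "-j"]) auto
  qed
  have fh: "f (h w) = 1 / w ^ k" if "w \<noteq> 0" "norm w < \<delta>" for w
  proof -
    have "f (h w) = exp (- of_nat k * Ln w)"
      unfolding h_def using in_H[of "Ln w"] that by (intro fg) auto
    also have "\<dots> = 1 / exp (Ln w) ^ k" by (simp add: exp_minus exp_of_nat_mult divide_inverse)
    finally show ?thesis using that by simp
  qed
  define D where "D = ball (0::complex) \<delta> - {0}"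
  have hhol: "h holomorphic_on D"
  proof -
    have "h field_differentiable at w" if "w \<in> D" for w
    proof -
      have w: "w \<noteq> 0" "norm w < \<delta>" using that by (auto simp: D_def)
      obtain l where "l holomorphic_on ball w (norm w)" and l: "\<And>x. x \<in> ball w (norm w) \<Longrightarrow> exp (l x) = x"
        using holomorphic_logarithm_exists[OF convex_ball open_ball, of "\<lambda>x. x" w "norm w" w] w
        by (metis centre_in_ball dist_0_norm dist_commute holomorphic_on_ident mem_ball less_irrefl zero_less_norm_iff)
      define U where "U = ball w (norm w) \<inter> ball 0 \<delta>"
      have "open U" "w \<in> U" using w by (auto simp: U_def)
      have "(\<lambda>x. - of_nat k * l x) holomorphic_on U"
        using \<open>l holomorphic_on _\<close> unfolding U_def
        by (intro holomorphic_intros) (auto elim: holomorphic_on_subset)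
      then have "(g \<circ> (\<lambda>x. - of_nat k * l x)) holomorphic_on U"
      proof (rule holomorphic_on_compose_gen[OF _ g])
        have "norm (exp (l x)) < \<delta>" if "x \<in> U" for x
          using that l[of x] by (simp add: U_def del: norm_exp_eq_Re)
        then show "(\<lambda>x. - of_nat k * l x) ` U \<subseteq> halfplane" using in_H by blast
      qed
      then have "h holomorphic_on U"
      proof (rule holomorphic_transform)
        show "(g \<circ> (\<lambda>x. - of_nat k * l x)) x = h x" if "x \<in> U" for x
          using that l[of x] h_eq[of "l x" x] by (simp add: U_def)
      qed
      then show ?thesis using \<open>open U\<close> \<open>w \<in> U\<close>
        using holomorphic_on_imp_differentiable_at by blast
    qed
    then show ?thesis by (simp add: holomorphic_on_def field_differentiable_at_within)
  qed
  have h_large: "\<exists>\<eta>. 0 < \<eta> \<and> \<eta> \<le> \<delta> \<and> (\<forall>w. w \<noteq> 0 \<longrightarrow> norm w < \<eta> \<longrightarrow> norm (h w) > B)" for B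
  proof -
    have "bounded (f ` cball 0 B)"
      using compact_continuous_image[OF cont_f compact_cball] compact_imp_bounded by blast
    then obtain C where C: "C > 0" "\<And>z. norm z \<le> B \<Longrightarrow> norm (f z) \<le> C"
      unfolding bounded_pos by auto
    \<comment> \<open>\<open>norm w < 1\<close> gives \<open>norm w ^ k \<le> norm w\<close>, so
      \<open>norm w < 1 / C\<close> makes \<open>norm (f (h w))\<close> exceed the bound
      \<open>C\<close> of \<open>f\<close> on \<open>cball 0 B\<close>.\<close>
    define \<eta> where "\<eta> = min \<delta> (min 1 (1 / C))"
    have "norm (h w) > B" if w: "w \<noteq> 0" "norm w < \<eta>" for w
    proof (rule ccontr)
      assume "\<not> norm (h w) > B"
      then have "norm (f (h w)) \<le> C" using C by simp
      then have "1 / norm w ^ k \<le> C" using fh[of w] w by (simp add: norm_divide norm_power \<eta>_def)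
      moreover have "norm w ^ k \<le> norm w ^ 1"
        using w k by (intro power_decreasing) (auto simp: \<eta>_def)
      moreover have "C * norm w < 1" using w C by (simp add: \<eta>_def field_simps)
      moreover have "norm w ^ k > 0" using w by simp
      ultimately show False using C
        by (simp add: divide_le_eq) (smt (verit) mult_left_mono)
    qed
    then show ?thesis using C \<delta> by (intro exI[of _ \<eta>]) (auto simp: \<eta>_def)
  qed
  obtain \<eta> where \<eta>: "0 < \<eta>" "\<eta> \<le> \<delta>" "\<And>w. w \<noteq> 0 \<Longrightarrow> norm w < \<eta> \<Longrightarrow> norm (h w) > 0"
    using h_large[of 0] by blast
  \<comment> \<open>\<open>h\<close> tends to infinity at 0, so its reciprocal has a removable
    singularity there with value 0.\<close>
  define q where "q w = (if w = 0 then 0 else inverse (h w))" for w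
  have "q \<midarrow>0\<rightarrow> 0"
  proof (rule Lim_transform_eventually)
    have "filterlim h at_infinity (at 0)"
      unfolding filterlim_at_infinity[OF order_refl] eventually_at
    proof (intro allI impI)
      fix B :: real assume "B > 0"
      from h_large[of B] obtain e where "0 < e" "\<forall>w. w \<noteq> 0 \<longrightarrow> norm w < e \<longrightarrow> norm (h w) > B" by blast
      then show "\<exists>d>0. \<forall>x\<in>UNIV. x \<noteq> 0 \<and> dist x 0 < d \<longrightarrow> B \<le> norm (h x)"
        by (intro exI[of _ e]) (auto intro: less_imp_le)
    qed
    then show "(\<lambda>w. inverse (h w)) \<midarrow>0\<rightarrow> 0"
      by (rule filterlim_compose[OF tendsto_inverse_0])
    show "\<forall>\<^sub>F w in at 0. inverse (h w) = q w"
      by (auto simp: eventually_at_filter q_def)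
  qed
  then have q_tendsto: "(q \<longlongrightarrow> q 0) (at 0 within ball 0 \<eta>)"
    by (auto simp: q_def intro: tendsto_within_subset)
  have qhol: "q holomorphic_on ball 0 \<eta>"
  proof (rule no_isolated_singularity'[where K = "{0}"])
    have "(\<lambda>w. inverse (h w)) holomorphic_on ball 0 \<eta> - {0}"
      using \<eta> by (intro holomorphic_intros holomorphic_on_subset[OF hhol]) (auto simp: D_def)
    then show "q holomorphic_on ball 0 \<eta> - {0}"
      by (rule holomorphic_transform) (auto simp: q_def)
  qed (use q_tendsto in auto)
  have q_nz: "q w \<noteq> 0" if "w \<noteq> 0" "norm w < \<eta>" for w using \<eta>(3)[OF that] that by (simp add: q_def)
  define e where "e = \<eta> / 2"
  have e: "0 < e" "e < \<eta>" using \<eta> by (auto simp: e_def)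
  have "\<not> q constant_on ball 0 e"
  proof
    assume "q constant_on ball 0 e"
    then have "q (of_real (e / 2)) = q 0" using e unfolding constant_on_def by fastforce
    moreover have "q (of_real (e / 2)) \<noteq> 0" using e by (intro q_nz) auto
    ultimately show False by (simp add: q_def)
  qed
  \<comment> \<open>Openness of the image around 0 shows that every \<open>z\<close> of large
    modulus is \<open>h w\<close> for some small \<open>w \<noteq> 0\<close>.\<close>
  then have "open (q ` ball 0 e)"
    using e holomorphic_on_subset[OF qhol subset_ball[of e \<eta> 0]]
    by (intro open_mapping_thm[of q "ball 0 e"]) auto
  moreover have "0 \<in> q ` ball 0 e" using e by (auto simp: q_def intro!: image_eqI[of _ _ 0])
  ultimately obtain s where s: "s > 0" "ball 0 s \<subseteq> q ` ball 0 e" by (rule openE)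
  have "continuous_on (cball 0 e) (deriv q)"
    using holomorphic_on_imp_continuous_on[OF holomorphic_deriv[OF qhol open_ball]] e
    by (auto elim: continuous_on_subset)
  then have "bounded (deriv q ` cball 0 e)"
    using compact_continuous_image compact_cball compact_imp_bounded by blast
  then obtain B where B: "B > 0" "\<And>w. w \<in> cball 0 e \<Longrightarrow> norm (deriv q w) \<le> B"
    unfolding bounded_pos by auto
  \<comment> \<open>For \<open>z = h w\<close> this bounds \<open>1 / norm w\<close> by
    \<open>B * norm z\<close>, which turns \<open>norm (f z) = (1 / norm w) ^ k\<close> into
    polynomial growth.\<close>
  have qB: "norm (q w) \<le> B * norm w" if "w \<in> cball 0 e" for w
  proof -
    have "norm (q w - q 0) \<le> B * norm (w - 0)"
    proof (rule field_differentiable_bound[OF convex_cball[of 0 e]])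
      show "(q has_field_derivative deriv q z) (at z within cball 0 e)" if "z \<in> cball 0 e" for z
        using that e holomorphic_derivI[OF qhol open_ball] by auto
    qed (use B that e in auto)
    then show ?thesis by (simp add: q_def)
  qed
  have poly_bound: "norm (f z) \<le> B ^ k * norm z ^ k" if z: "2 / s \<le> norm z" for z
  proof -
    have "norm z > 0" using z s by (smt (verit) divide_pos_pos)
    then have "inverse z \<in> ball 0 s" using z s by (simp add: inverse_eq_divide norm_divide field_simps)
    then obtain w where w: "w \<in> ball 0 e" "inverse z = q w" using s by blast
    then have "w \<noteq> 0" using \<open>norm z > 0\<close> by (auto simp: q_def)
    then have zh: "z = h w" using w by (simp add: q_def)
    have "norm (inverse z) \<le> B * norm w" using qB[of w] w(1) unfolding w(2) by simp
    then have "inverse (norm z) \<le> B * norm w" by (simp only: norm_inverse)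
    then have "1 / norm w \<le> B * norm z" using \<open>norm z > 0\<close> \<open>w \<noteq> 0\<close> by (simp add: field_simps)
    then have "(1 / norm w) ^ k \<le> (B * norm z) ^ k" by (intro power_mono) auto
    moreover have "norm (f z) = (1 / norm w) ^ k"
      unfolding zh using fh[of w] w e \<eta> \<open>w \<noteq> 0\<close> by (simp add: norm_divide norm_power power_divide)
    ultimately show ?thesis by (simp add: power_mult_distrib)
  qed
  \<comment> \<open>These are the Taylor coefficients of \<open>f\<close> at 0; by the extended
    Liouville theorem the series stops at degree \<open>k\<close>.\<close>
  define c where "c i = (deriv ^^ i) f 0 / fact i" for i
  have "f z = poly (\<Sum>i\<le>k. monom (c i) i) z" for z
    using Liouville_polynomial[OF entire poly_bound, where \<xi> = z] by (simp add: poly_sum poly_monom c_def)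
  then show False using transc unfolding transcendental_entire_def by blast
qed

section \<open>The derivative estimate and growth along horizontal segments\<close>

lemma halfplane_lift_log_deriv:
  assumes transc: "transcendental_entire f" and f0: "norm (f 0) \<le> R"
    and g: "g holomorphic_on halfplane" and fg: "\<And>\<zeta>. \<zeta> \<in> halfplane \<Longrightarrow> f (g \<zeta>) = exp \<zeta>"
  obtains G where "G holomorphic_on halfplane" "\<And>\<zeta>. \<zeta> \<in> halfplane \<Longrightarrow> exp (G \<zeta>) = g \<zeta>"
    "\<And>\<zeta>. \<zeta> \<in> halfplane \<Longrightarrow> norm (deriv G \<zeta>) * (Re \<zeta> - ln R) \<le> 48 * pi"
proof -
  have inj: "inj_on g halfplane" by (rule halfplane_lift_inj[OF transc g fg])
  \<comment> \<open>At a zero of \<open>g\<close> the value \<open>f 0\<close> would have modulus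
    above \<open>R\<close>. So \<open>g\<close> has a holomorphic logarithm.\<close>
  have g0: "g \<zeta> \<noteq> 0" if "\<zeta> \<in> halfplane" for \<zeta>
    using fg[OF that] norm_exp_halfplane[OF that] f0 by (metis not_less)
  have "complex_of_real (ln R + 1) \<in> halfplane" by simp
  then obtain G where G: "G holomorphic_on halfplane" "\<And>\<zeta>. \<zeta> \<in> halfplane \<Longrightarrow> exp (G \<zeta>) = g \<zeta>"
    using holomorphic_logarithm_exists[OF convex_halfspace_Re_gt open_halfspace_Re_gt g g0] by metis
  have "norm (deriv G \<zeta>) * (Re \<zeta> - ln R) \<le> 48 * pi" if \<zeta>: "\<zeta> \<in> halfplane" for \<zeta>
  proof (rule ccontr)
    assume big: "\<not> norm (deriv G \<zeta>) * (Re \<zeta> - ln R) \<le> 48 * pi"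
    define d where "d = Re \<zeta> - ln R"
    have d: "d > 0" using \<zeta> by (simp add: d_def)
    have sub: "ball \<zeta> d \<subseteq> halfplane"
    proof
      fix x assume "x \<in> ball \<zeta> d"
      then have "norm (\<zeta> - x) < d" by (simp add: dist_norm)
      then have "Re (\<zeta> - x) < d" using complex_Re_le_cmod[of "\<zeta> - x"] by linarith
      then show "x \<in> halfplane" by (simp add: d_def)
    qed
    \<comment> \<open>Bloch's theorem on the disc of radius \<open>d\<close> gives an image disc of
      radius \<open>d * norm (deriv G \<zeta>) / 12\<close>. The constant 48 makes this at least
      \<open>4 * pi\<close>, enough room for the centre \<open>b\<close> and
      \<open>b + 2 * pi * \<i>\<close>.\<close>
    have "4 * pi \<le> d * norm (deriv G \<zeta>) / 12" using big by (simp add: d_def mult.commute)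
    then obtain b where b: "ball b (4 * pi) \<subseteq> G ` ball \<zeta> d"
      using Bloch[OF holomorphic_on_subset[OF G(1) sub] d] by blast
    have "b \<in> ball b (4 * pi)" "b + 2 * pi * \<i> \<in> ball b (4 * pi)"
      by (auto simp: dist_norm norm_mult)
    then have "b \<in> G ` ball \<zeta> d" "b + 2 * pi * \<i> \<in> G ` ball \<zeta> d"
      using b by blast+
    then obtain x y where xy: "x \<in> ball \<zeta> d" "G x = b" "y \<in> ball \<zeta> d" "G y = b + 2 * pi * \<i>"
      by (elim imageE) simp
    have "g x = exp (G x)" "g y = exp (G y)"
      using G(2)[OF subsetD[OF sub xy(1)]] G(2)[OF subsetD[OF sub xy(3)]] by simp_all
    moreover have "exp (G y) = exp (G x)" unfolding xy by (simp add: exp_add)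
    ultimately have "g x = g y" by (simp only:)
    then have "x = y" by (rule inj_onD[OF inj _ subsetD[OF sub xy(1)] subsetD[OF sub xy(3)]])
    with xy show False by simp
  qed
  with G that show ?thesis by blast
qed

text \<open>Moving right from \<open>\<zeta>0\<close> by \<open>K\<close> times its distance
  \<open>a\<close> from the boundary adds \<open>K * a\<close> to \<open>ln (norm (f z))\<close>. On
  the way \<open>norm (deriv G)\<close> is at most \<open>48 * pi / a\<close>, so \<open>a\<close>
  cancels and the factor in \<open>norm z\<close> depends on \<open>K\<close> alone.\<close>

lemma forward_growth:
  assumes transc: "transcendental_entire f" and f0: "norm (f 0) \<le> R"
    and z0: "norm (f z0) > R" and K: "K \<ge> 0"
  obtains z where "norm z \<le> norm z0 * exp (48 * pi * K)"
    "ln (norm (f z)) = ln (norm (f z0)) + K * (ln (norm (f z0)) - ln R)"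
proof -
  obtain g \<zeta>0 where g: "g holomorphic_on halfplane" and fg: "\<And>\<zeta>. \<zeta> \<in> halfplane \<Longrightarrow> f (g \<zeta>) = exp \<zeta>"
    and \<zeta>0: "Re \<zeta>0 = ln (norm (f z0))" "g \<zeta>0 = z0"
    using halfplane_lift[OF z0] by blast
  obtain G where G: "G holomorphic_on halfplane" "\<And>\<zeta>. \<zeta> \<in> halfplane \<Longrightarrow> exp (G \<zeta>) = g \<zeta>"
    "\<And>\<zeta>. \<zeta> \<in> halfplane \<Longrightarrow> norm (deriv G \<zeta>) * (Re \<zeta> - ln R) \<le> 48 * pi"
    using halfplane_lift_log_deriv[OF transc f0 g fg] by blast
  define a where "a = Re \<zeta>0 - ln R"
  have "f z0 \<noteq> 0" using z0 R_pos by auto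
  then have a: "a > 0" using z0 R_pos ln_less_cancel_iff[of R "norm (f z0)"] by (simp add: a_def \<zeta>0(1))
  define \<zeta>1 where "\<zeta>1 = \<zeta>0 + of_real (K * a)"
  define S where "S = {\<zeta>. Re \<zeta> \<ge> Re \<zeta>0}"
  have S: "S \<subseteq> halfplane" using a by (auto simp: S_def a_def)
  have in_S: "\<zeta>0 \<in> S" "\<zeta>1 \<in> S" using K a by (auto simp: S_def \<zeta>1_def)
  have "norm (G \<zeta>1 - G \<zeta>0) \<le> 48 * pi / a * norm (\<zeta>1 - \<zeta>0)"
  proof (rule field_differentiable_bound[where S = S and f' = "deriv G"])
    show "convex S" unfolding S_def by (rule convex_halfspace_Re_ge)
    fix z assume z: "z \<in> S"
    then have "z \<in> halfplane" using S by blast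
    then show "(G has_field_derivative deriv G z) (at z within S)"
      using holomorphic_derivI[OF G(1) open_halfspace_Re_gt] by blast
    have "norm (deriv G z) * a \<le> norm (deriv G z) * (Re z - ln R)"
      using z by (intro mult_left_mono) (auto simp: S_def a_def)
    also have "\<dots> \<le> 48 * pi" by (rule G(3)[OF \<open>z \<in> halfplane\<close>])
    finally show "norm (deriv G z) \<le> 48 * pi / a" using a by (simp add: field_simps)
  qed (use in_S in auto)
  also have "\<dots> = 48 * pi * K" using a K by (simp add: \<zeta>1_def norm_mult)
  finally have "Re (G \<zeta>1 - G \<zeta>0) \<le> 48 * pi * K" using complex_Re_le_cmod order_trans by blast
  then have "exp (Re (G \<zeta>1)) \<le> exp (Re (G \<zeta>0)) * exp (48 * pi * K)" by (simp flip: exp_add)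
  moreover have "exp (Re (G \<zeta>1)) = norm (g \<zeta>1)" "exp (Re (G \<zeta>0)) = norm z0"
    using G(2)[of \<zeta>1] G(2)[of \<zeta>0] in_S S \<zeta>0(2) by (auto simp flip: norm_exp_eq_Re)
  ultimately have "norm (g \<zeta>1) \<le> norm z0 * exp (48 * pi * K)" by simp
  moreover have "norm (f (g \<zeta>1)) = exp (Re \<zeta>0 + K * a)"
    using fg[of \<zeta>1] in_S S by (auto simp: \<zeta>1_def)
  then have "ln (norm (f (g \<zeta>1))) = ln (norm (f z0)) + K * (ln (norm (f z0)) - ln R)"
    by (simp add: \<zeta>0(1) a_def)
  ultimately show ?thesis using that by blast
qed

end

section \<open>Monotonicity and left continuity of the maximum modulus\<close>

lemma max_modulus_attained:
  assumes "f holomorphic_on UNIV" "r \<ge> 0"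
  obtains z where "norm z = r" "norm (f z) = max_modulus f r"
proof -
  have cont: "continuous_on (sphere 0 r) (\<lambda>z. norm (f z))"
    using assms(1) holomorphic_on_imp_continuous_on continuous_on_subset
    by (intro continuous_on_norm) blast
  have "complex_of_real r \<in> sphere 0 r" using assms(2) by simp
  then obtain z where z: "z \<in> sphere 0 r" "\<And>y. y \<in> sphere 0 r \<Longrightarrow> norm (f y) \<le> norm (f z)"
    using continuous_attains_sup[OF compact_sphere _ cont] by blast
  then have "max_modulus f r = norm (f z)"
    unfolding max_modulus_def by (intro cSup_eq_maximum) auto
  with z(1) show ?thesis using that by auto
qed

text \<open>The maximum principle passes from the circle to the disc; monotonicity of
  \<open>max_modulus\<close> follows.\<close>

lemma norm_le_max_modulus:
  assumes f: "f holomorphic_on UNIV" and "norm z \<le> r"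
  shows "norm (f z) \<le> max_modulus f r"
proof -
  have bdd: "bdd_above ((\<lambda>z. norm (f z)) ` sphere 0 r)"
  proof (intro bounded_imp_bdd_above compact_imp_bounded compact_continuous_image compact_sphere)
    show "continuous_on (sphere 0 r) (\<lambda>z. norm (f z))"
      using f holomorphic_on_imp_continuous_on continuous_on_subset
      by (intro continuous_on_norm) blast
  qed
  show ?thesis
  proof (rule maximum_modulus_frontier[of f "cball 0 r"])
    show "f holomorphic_on interior (cball 0 r)" "continuous_on (closure (cball 0 r)) f"
      using f holomorphic_on_subset holomorphic_on_imp_continuous_on by blast+
    show "norm (f w) \<le> max_modulus f r" if "w \<in> frontier (cball 0 r)" for w
      unfolding max_modulus_def using that bdd by (intro cSUP_upper2[of _ _ w]) auto
  qed (use assms in auto)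
qed

lemma max_modulus_nonneg: "f holomorphic_on UNIV \<Longrightarrow> 0 \<le> r \<Longrightarrow> 0 \<le> max_modulus f r"
  using max_modulus_attained norm_ge_zero by metis

lemma max_modulus_mono:
  assumes "f holomorphic_on UNIV" "0 \<le> r" "r \<le> s"
  shows "max_modulus f r \<le> max_modulus f s"
proof -
  obtain z where "norm z = r" "norm (f z) = max_modulus f r"
    using max_modulus_attained[OF assms(1,2)] by blast
  with norm_le_max_modulus[OF assms(1), of z s] assms(3) show ?thesis by simp
qed

text \<open>A point of maximum modulus is moved slightly inwards along its radius; continuity of
  \<open>f\<close> keeps the modulus above \<open>c\<close>.\<close>

lemma max_modulus_left_continuous:
  assumes f: "f holomorphic_on UNIV" and "0 < r" and c: "c < max_modulus f r"
  obtains s where "0 < s" "s < r" "c < max_modulus f s"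
proof -
  obtain z where z: "norm z = r" "norm (f z) = max_modulus f r"
    using max_modulus_attained[OF f] assms(2) by (metis less_imp_le)
  have "continuous_on UNIV (\<lambda>t. norm (f (of_real t * z)))"
    by (intro continuous_on_norm continuous_on_compose2[OF holomorphic_on_imp_continuous_on[OF f]]
        continuous_intros) auto
  then have "((\<lambda>t. norm (f (of_real t * z))) \<longlongrightarrow> norm (f (of_real 1 * z))) (at 1)"
    using continuous_on_def by blast
  then have "((\<lambda>t. norm (f (of_real t * z))) \<longlongrightarrow> norm (f z)) (at_left 1)"
    unfolding of_real_1 mult_1 by (rule tendsto_within_subset) simp
  then have "\<forall>\<^sub>F t in at_left 1. c < norm (f (of_real t * z))"
    using c z by (intro order_tendstoD) auto
  moreover have "\<forall>\<^sub>F t in at_left (1::real). t \<in> {0<..<1}"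
    by (rule eventually_at_left_real) simp
  ultimately have "\<forall>\<^sub>F t in at_left 1. c < norm (f (of_real t * z)) \<and> t \<in> {0<..<1}"
    by eventually_elim auto
  then obtain t where t: "c < norm (f (of_real t * z))" "0 < t" "t < 1"
    using eventually_happens'[OF trivial_limit_at_left_real] by fastforce
  show ?thesis
  proof (rule that[of "t * r"])
    have "norm (of_real t * z) = t * r" using t z by (simp add: norm_mult)
    then show "c < max_modulus f (t * r)"
      using t norm_le_max_modulus[OF f, of "of_real t * z" "t * r"] by simp
  qed (use t assms in auto)
qed

lemma mu_mono:
  "f holomorphic_on UNIV \<Longrightarrow> 0 < \<epsilon> \<Longrightarrow> 0 \<le> r \<Longrightarrow> r \<le> s \<Longrightarrow> mu f \<epsilon> r \<le> mu f \<epsilon> s"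
  unfolding mu_def by (intro powr_mono2 max_modulus_mono max_modulus_nonneg) auto

lemma mu_left_continuous:
  assumes f: "f holomorphic_on UNIV" and \<epsilon>: "0 < \<epsilon>" and "0 < r" "0 \<le> c" and c: "c < mu f \<epsilon> r"
  obtains s where "0 < s" "s < r" "c < mu f \<epsilon> s"
proof -
  have "c powr (1 / \<epsilon>) < mu f \<epsilon> r powr (1 / \<epsilon>)"
    using assms by (intro powr_less_mono2) auto
  also have "\<dots> = max_modulus f r"
    using \<epsilon> max_modulus_nonneg[OF f] assms(3) by (simp add: mu_def powr_powr)
  finally obtain s where s: "0 < s" "s < r" "c powr (1 / \<epsilon>) < max_modulus f s"
    using max_modulus_left_continuous[OF f assms(3)] by blast
  have "c = (c powr (1 / \<epsilon>)) powr \<epsilon>" using \<epsilon> assms(4) by (simp add: powr_powr)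
  also have "\<dots> < mu f \<epsilon> s" unfolding mu_def using s \<epsilon> by (intro powr_less_mono2) auto
  finally show ?thesis using s that by blast
qed

section \<open>Iteration from an admissible radius\<close>

lemma admissible_iterate_ge:
  assumes "admissible_radius m R" "R \<le> x"
  shows "x \<le> (m ^^ n) x"
proof (induction n)
  case (Suc n)
  then have "(m ^^ n) x < m ((m ^^ n) x)" using assms by (simp add: admissible_radius_def)
  with Suc show ?case by simp
qed simp

lemma admissible_iterate_mono:
  assumes "admissible_radius m R" "\<And>r s. 0 < r \<Longrightarrow> r \<le> s \<Longrightarrow> m r \<le> m s" "R \<le> x" "x \<le> y"
  shows "(m ^^ n) x \<le> (m ^^ n) y"
proof (induction n)
  case (Suc n)
  have "0 < (m ^^ n) x"
    using admissible_iterate_ge[OF assms(1,3), of n] assms(1,3) by (simp add: admissible_radius_def)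
  with Suc assms(2) show ?case by simp
qed (use assms in simp)

text \<open>If the iterates were bounded with supremum \<open>L\<close>, then
  \<open>L < m L\<close>, and \<open>left\<close> would give \<open>s < L\<close> with
  \<open>L < m s\<close>. Some iterate exceeds \<open>s\<close>, so the next one would exceed
  \<open>L\<close>.\<close>

lemma admissible_iterate_unbounded:
  assumes adm: "admissible_radius m R"
    and mono: "\<And>r s. 0 < r \<Longrightarrow> r \<le> s \<Longrightarrow> m r \<le> m s"
    and left: "\<And>r. 0 < r \<Longrightarrow> r < m r \<Longrightarrow> \<exists>s. 0 < s \<and> s < r \<and> r < m s"
  shows "\<exists>n. B \<le> (m ^^ n) R"
proof (rule ccontr)
  assume "\<nexists>n. B \<le> (m ^^ n) R"
  then have bdd: "bdd_above (range (\<lambda>n. (m ^^ n) R))"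
    by (intro bdd_aboveI[of _ B]) (auto simp: not_le intro: less_imp_le)
  define L where "L = (SUP n. (m ^^ n) R)"
  have up: "(m ^^ n) R \<le> L" for n unfolding L_def using bdd by (intro cSUP_upper) auto
  have "R \<le> L" using up[of 0] by simp
  then have "0 < L" "L < m L" using adm by (auto simp: admissible_radius_def)
  then obtain s where s: "0 < s" "s < L" "L < m s" using left by blast
  then obtain n where "s < (m ^^ n) R"
    using less_cSUP_iff[OF _ bdd, of s] by (auto simp: L_def)
  with mono[OF s(1)] have "m s \<le> (m ^^ Suc n) R" by simp
  with s up[of "Suc n"] show False by simp
qed

section \<open>Comparison of \<open>mu\<close> with the square of the maximum modulus\<close>

lemma (in log_covering) max_modulus_square_growth:
  assumes transc: "transcendental_entire f" and f0: "norm (f 0) \<le> R" and R1: "R > 1"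
    and adm: "admissible_radius (max_modulus f) r0" and \<epsilon>: "0 < \<epsilon>"
  obtains s0 where "\<And>s. s \<ge> s0 \<Longrightarrow> (max_modulus f s)\<^sup>2 \<le> mu f \<epsilon> (s\<^sup>2)"
proof -
  \<comment> \<open>Since \<open>ln M - ln R \<ge> ln M / 2\<close>, this \<open>K\<close> raises
    the logarithm to at least \<open>2 / \<epsilon> * ln M\<close>; the power
    \<open>\<epsilon>\<close> then leaves \<open>2 * ln M\<close>.\<close>
  define K where "K = 4 / \<epsilon>"
  have K: "K > 0" using \<epsilon> by (simp add: K_def)
  \<comment> \<open>\<open>r0\<close> ensures \<open>s < M\<close>, \<open>R\<^sup>2\<close> then
    ensures \<open>2 * ln R < ln M\<close>, and the exponential is the factor lost in
    \<open>norm z\<close>, so that \<open>norm z \<le> s * s\<close>.\<close>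
  define s0 where "s0 = max r0 (max (R\<^sup>2) (exp (48 * pi * K)))"
  have "(max_modulus f s)\<^sup>2 \<le> mu f \<epsilon> (s\<^sup>2)" if "s \<ge> s0" for s
  proof -
    define M where "M = max_modulus f s"
    have s: "r0 \<le> s" "R\<^sup>2 \<le> s" "exp (48 * pi * K) \<le> s" using that by (auto simp: s0_def)
    have "s < M" using adm s by (simp add: M_def admissible_radius_def)
    have "R < R\<^sup>2" using R1 by (simp add: power2_eq_square)
    then have M: "R\<^sup>2 < M" "R < M" "1 < M" using \<open>s < M\<close> s R1 by auto
    have s0: "s > 0" using s(3) exp_gt_zero order_less_le_trans by blast
    have "ln (R\<^sup>2) < ln M" using M R_pos by (subst ln_less_cancel_iff) auto
    then have lnM: "2 * ln R < ln M" using R_pos by (simp add: ln_realpow)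
    obtain z0 where z0: "norm z0 = s" "norm (f z0) = M"
      using max_modulus_attained[OF entire, of s] s0 by (auto simp: M_def)
    obtain z where z: "norm z \<le> norm z0 * exp (48 * pi * K)"
      "ln (norm (f z)) = ln M + K * (ln M - ln R)"
      using forward_growth[OF transc f0, of z0 K] M z0 K by auto
    have "norm z \<le> s * s" using z(1) z0(1) s(3) s0 by (auto intro: order_trans mult_left_mono)
    then have fz: "norm (f z) \<le> max_modulus f (s\<^sup>2)"
      by (intro norm_le_max_modulus[OF entire]) (simp add: power2_eq_square)
    have lnM0: "ln M > 0" using M by simp
    have "K * (ln M / 2) \<le> K * (ln M - ln R)" using K lnM by (intro mult_left_mono) auto
    then have "ln (norm (f z)) \<ge> 2 / \<epsilon> * ln M" using lnM0 by (simp add: z(2) K_def)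
    then have ln2: "2 * ln M \<le> \<epsilon> * ln (norm (f z))" using \<epsilon> by (simp add: field_simps)
    with lnM0 have "\<epsilon> * ln (norm (f z)) > 0" by linarith
    then have "f z \<noteq> 0" by auto
    have "M\<^sup>2 = exp (2 * ln M)" using M by (simp add: exp_double)
    also have "\<dots> \<le> exp (\<epsilon> * ln (norm (f z)))" using ln2 by simp
    also have "\<dots> = norm (f z) powr \<epsilon>" using \<open>f z \<noteq> 0\<close> by (simp add: powr_def)
    also have "\<dots> \<le> mu f \<epsilon> (s\<^sup>2)" unfolding mu_def using fz \<epsilon> by (intro powr_mono2) auto
    finally show ?thesis by (simp add: M_def)
  qed
  then show ?thesis by (rule that)
qed

lemma class_B_square_growth:
  assumes f: "f \<in> class_B" and adm: "admissible_radius (max_modulus f) r0" and \<epsilon>: "0 < \<epsilon>"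
  obtains s0 where "\<And>s. s \<ge> s0 \<Longrightarrow> (max_modulus f s)\<^sup>2 \<le> mu f \<epsilon> (s\<^sup>2)"
proof -
  have transc: "transcendental_entire f" and "bounded (singular_values f)"
    using f by (auto simp: class_B_def)
  then obtain B where B: "\<And>w. w \<in> singular_values f \<Longrightarrow> norm w \<le> B"
    unfolding bounded_iff by blast
  \<comment> \<open>The 2 gives \<open>R > 1\<close>, and \<open>norm (f 0)\<close> keeps the
    inverse branches away from 0.\<close>
  define R where "R = max B (max (norm (f 0)) 2)"
  have "log_covering f R"
  proof
    show "f holomorphic_on UNIV" using transc by (simp add: transcendental_entire_def)
    show "deriv f z \<noteq> 0" if "R < norm (f z)" for z
    proof
      assume "deriv f z = 0"
      then have "f z \<in> singular_values f" by (auto simp: singular_values_def critical_values_def)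
      with B that show False by (force simp: R_def)
    qed
    show "norm a \<le> R" if "a \<in> asymptotic_values f" for a
      using B[of a] that by (auto simp: R_def singular_values_def)
  qed (simp add: R_def)
  then show ?thesis
    by (rule log_covering.max_modulus_square_growth[OF _ transc _ _ adm \<epsilon>])
      (use that in \<open>auto simp: R_def\<close>)
qed

section \<open>Equality of the escaping sets\<close>

theorem theorem1p1:
  fixes f :: "complex \<Rightarrow> complex" and R :: real and \<rho> :: "real \<Rightarrow> real"
  assumes "f \<in> class_B"
    and "admissible_radius (max_modulus f) R"
    and "\<And>\<epsilon>. \<lbrakk>0 < \<epsilon>; \<epsilon> < 1\<rbrakk> \<Longrightarrow> admissible_radius (mu f \<epsilon>) (\<rho> \<epsilon>)"
  shows "quite_fast_escaping_set f \<rho> = fast_escaping_set f R"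
proof (intro equalityI subsetI)
  let ?M = "max_modulus f"
  have f: "f holomorphic_on UNIV" using assms(1) by (simp add: class_B_def transcendental_entire_def)
  have M_mono: "?M r \<le> ?M s" if "0 < r" "r \<le> s" for r s
    using max_modulus_mono[OF f] that by simp
  {
    fix z assume "z \<in> quite_fast_escaping_set f \<rho>"
    then obtain \<epsilon> l where \<epsilon>: "0 < \<epsilon>" "\<epsilon> < 1" and "l \<ge> 1"
      and l: "\<And>n. n \<ge> 1 \<Longrightarrow> (mu f \<epsilon> ^^ n) (\<rho> \<epsilon>) \<le> norm ((f ^^ (n + l)) z)"
      by (auto simp: quite_fast_escaping_set_def Q_set_def)
    let ?\<mu> = "mu f \<epsilon>"
    have adm: "admissible_radius ?\<mu> (\<rho> \<epsilon>)" using assms(3) \<epsilon> by blast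
    have \<mu>_mono: "?\<mu> r \<le> ?\<mu> s" if "0 < r" "r \<le> s" for r s
      using mu_mono[OF f \<epsilon>(1)] that by simp
    obtain s0 where s0: "\<And>s. s \<ge> s0 \<Longrightarrow> (?M s)\<^sup>2 \<le> ?\<mu> (s\<^sup>2)"
      using class_B_square_growth[OF assms(1,2) \<epsilon>(1)] by blast
    \<comment> \<open>\<open>S\<close> lies beyond both starting radii and the threshold
      \<open>s0\<close>, and is at least 1 so that squaring does not decrease it or its
      iterates.\<close>
    define S where "S = max (max s0 1) (max R (\<rho> \<epsilon>))"
    have S: "s0 \<le> S" "1 \<le> S" "R \<le> S" "\<rho> \<epsilon> \<le> S" by (auto simp: S_def)
    have "S \<le> S\<^sup>2" using S by (simp add: power2_eq_square)
    have M_ge: "S \<le> (?M ^^ n) S" for n using admissible_iterate_ge[OF assms(2) S(3)] .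
    have sq: "((?M ^^ n) S)\<^sup>2 \<le> (?\<mu> ^^ n) (S\<^sup>2)" for n
    proof (induction n)
      case (Suc n)
      have "((?M ^^ Suc n) S)\<^sup>2 \<le> ?\<mu> (((?M ^^ n) S)\<^sup>2)" using s0[of "(?M ^^ n) S"] M_ge[of n] S by simp
      also have "\<dots> \<le> ?\<mu> ((?\<mu> ^^ n) (S\<^sup>2))" using Suc M_ge[of n] S by (intro \<mu>_mono) auto
      finally show ?case by simp
    qed simp
    \<comment> \<open>\<open>N\<close> iterations carry the starting radius past
      \<open>S\<^sup>2\<close>; the delay is absorbed by replacing \<open>l\<close> with
      \<open>N + l\<close>.\<close>
    obtain N where N: "S\<^sup>2 \<le> (?\<mu> ^^ N) (\<rho> \<epsilon>)"
      using admissible_iterate_unbounded[OF adm \<mu>_mono] mu_left_continuous[OF f \<epsilon>(1)]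
      by (metis less_imp_le)
    have "(?M ^^ n) R \<le> norm ((f ^^ (n + (N + l))) z)" if "n \<ge> 1" for n
    proof -
      have "(?M ^^ n) R \<le> (?M ^^ n) S"
        using admissible_iterate_mono[OF assms(2) M_mono order_refl S(3)] .
      also have "\<dots> \<le> ((?M ^^ n) S)\<^sup>2" using M_ge[of n] S by (simp add: power2_eq_square)
      also have "\<dots> \<le> (?\<mu> ^^ n) (S\<^sup>2)" by (rule sq)
      also have "\<dots> \<le> (?\<mu> ^^ n) ((?\<mu> ^^ N) (\<rho> \<epsilon>))"
        using S \<open>S \<le> S\<^sup>2\<close> by (intro admissible_iterate_mono[OF adm \<mu>_mono _ N]) auto
      also have "\<dots> = (?\<mu> ^^ (n + N)) (\<rho> \<epsilon>)" by (simp add: funpow_add)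
      also have "\<dots> \<le> norm ((f ^^ (n + N + l)) z)" using that by (intro l) simp
      finally show ?thesis by (simp add: add.assoc)
    qed
    then show "z \<in> fast_escaping_set f R"
      using \<open>l \<ge> 1\<close> by (auto simp: fast_escaping_set_def intro!: exI[of _ "N + l"])
  next
    fix z assume "z \<in> fast_escaping_set f R"
    then obtain l where "l \<ge> 1" and l: "\<And>n. n \<ge> 1 \<Longrightarrow> (?M ^^ n) R \<le> norm ((f ^^ (n + l)) z)"
      by (auto simp: fast_escaping_set_def)
    \<comment> \<open>For this inclusion a single exponent suffices; 1/2 is an arbitrary
      choice.\<close>
    let ?\<mu> = "mu f (1/2)" and ?r = "\<rho> (1/2)"
    have adm: "admissible_radius ?\<mu> ?r" using assms(3)[of "1/2"] by simp
    have \<mu>_mono: "?\<mu> r \<le> ?\<mu> s" if "0 < r" "r \<le> s" for r s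
      using mu_mono[OF f] that by simp
    \<comment> \<open>The 1 ensures \<open>?M r \<ge> 1\<close> for \<open>r \<ge> T\<close>, where
      taking the square root cannot increase the value.\<close>
    define T where "T = max 1 (max R ?r)"
    have T: "1 \<le> T" "R \<le> T" "?r \<le> T" by (auto simp: T_def)
    have \<mu>_le: "?\<mu> r \<le> ?M r" if "T \<le> r" for r
    proof -
      have "r < ?M r" using assms(2) that T by (simp add: admissible_radius_def)
      then have "1 \<le> ?M r" using that T by simp
      then show ?thesis using powr_mono[of "1/2" 1 "?M r"] by (simp add: mu_def)
    qed
    have le: "(?\<mu> ^^ n) T \<le> (?M ^^ n) T" for n
    proof (induction n)
      case (Suc n)
      have "T \<le> (?\<mu> ^^ n) T" using admissible_iterate_ge[OF adm T(3)] .
      then have "(?\<mu> ^^ Suc n) T \<le> ?M ((?\<mu> ^^ n) T)" using \<mu>_le by simp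
      also have "\<dots> \<le> ?M ((?M ^^ n) T)" using Suc \<open>T \<le> (?\<mu> ^^ n) T\<close> T by (intro M_mono) auto
      finally show ?case by simp
    qed simp
    obtain N where N: "T \<le> (?M ^^ N) R"
      using admissible_iterate_unbounded[OF assms(2) M_mono] max_modulus_left_continuous[OF f] by metis
    have "(?\<mu> ^^ n) ?r \<le> norm ((f ^^ (n + (N + l))) z)" if "n \<ge> 1" for n
    proof -
      have "(?\<mu> ^^ n) ?r \<le> (?\<mu> ^^ n) T"
        using admissible_iterate_mono[OF adm \<mu>_mono order_refl T(3)] .
      also have "\<dots> \<le> (?M ^^ n) T" by (rule le)
      also have "\<dots> \<le> (?M ^^ n) ((?M ^^ N) R)"
        by (rule admissible_iterate_mono[OF assms(2) M_mono T(2) N])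
      also have "\<dots> = (?M ^^ (n + N)) R" by (simp add: funpow_add)
      also have "\<dots> \<le> norm ((f ^^ (n + N + l)) z)" using that by (intro l) simp
      finally show ?thesis by (simp add: add.assoc)
    qed
    then have "z \<in> Q_set f (1/2) ?r"
      using \<open>l \<ge> 1\<close> by (auto simp: Q_set_def intro!: exI[of _ "N + l"])
    then show "z \<in> quite_fast_escaping_set f \<rho>"
      unfolding quite_fast_escaping_set_def by (intro UN_I[of "1/2"]) auto
  }
qed

end
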